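(* Let $(T,*,[\![\,,\,,\,]\!])$ be a real two-dimensional Bol algebra whose binary operation $*$ is nonzero. Then there does not exist any quadratic structure on $T$; that is, there is no nondegenerate symmetric bilinear form $b:T\times T\to\mathbb{R}$ which is invariant on $T$.
   Context: A (left) Bol algebra is a triple $(T,*,[\![\,,\,,\,]\!])$ consisting of a real vector space $T$, a bilinear operation $*:T\times T\to T$ and a trilinear operation $[\![\,,\,,\,]\!]:T\times T\times T\to T$ such that for all $u,v,x,y,z\in T$: (T01) $x*y=-y*x$; (T02) $[\![x,y,z]\!]=-[\![y,x,z]\!]$; (T1) $[\![x,y,z]\!]+[\![y,z,x]\!]+[\![z,x,y]\!]=0$; (T2) $[\![u,v,[\![x,y,z]\!]]\!]=[\![[\![u,v,x]\!],y,z]\!]+[\![x,[\![u,v,y]\!],z]\!]+[\![x,y,[\![u,v,z]\!]]\!]$; (T3) $[\![u,v,x*y]\!]=[\![u,v,x]\!]*y+x*[\![u,v,y]\!]+[\![x,y,u*v]\!]-(x*y)*(u*v)$. A symmetric bilinear form $b:T\times T\to\mathbb{R}$ is called invariant on $T$ if for all $x,y,z,u\in T$ it satisfies $b(x*y,z)=b(x,y*z)$ and either of the following two conditions (which are equivalent for symmetric $b$): $b([\![x,y,z]\!],u)=b([\![z,u,x]\!],y)$, or $b([\![x,y,z]\!],u)=-b(z,[\![x,y,u]\!])$. A quadratic structure on $T$ is a nondegenerate invariant symmetric bilinear form. *)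

theory Defs
  imports "HOL-Analysis.Analysis"
begin

definition trilinear ::
  "('a::real_vector \<Rightarrow> 'a \<Rightarrow> 'a \<Rightarrow> 'a) \<Rightarrow> bool" where
  "trilinear f \<longleftrightarrow>
     (\<forall>y z. linear (\<lambda>x. f x y z)) \<and>
     (\<forall>x z. linear (\<lambda>y. f x y z)) \<and>
     (\<forall>x y. linear (\<lambda>z. f x y z))"

text \<open>Left Bol algebras. The underlying vector space is the whole type \<open>'a\<close>.\<close>

locale bol_algebra =
  fixes mul :: "'a::real_vector \<Rightarrow> 'a \<Rightarrow> 'a"  (infixl "\<star>" 70)
    and br :: "'a \<Rightarrow> 'a \<Rightarrow> 'a \<Rightarrow> 'a"  ("\<lbrakk>_,/ _,/ _\<rbrakk>")
  assumes bilinear_mul: "bilinear mul"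
    and trilinear_br: "trilinear br"
    and T01: "x \<star> y = - (y \<star> x)"
    and T02: "\<lbrakk>x, y, z\<rbrakk> = - \<lbrakk>y, x, z\<rbrakk>"
    and T1: "\<lbrakk>x, y, z\<rbrakk> + \<lbrakk>y, z, x\<rbrakk> + \<lbrakk>z, x, y\<rbrakk> = 0"
    and T2: "\<lbrakk>u, v, \<lbrakk>x, y, z\<rbrakk>\<rbrakk> =
               \<lbrakk>\<lbrakk>u, v, x\<rbrakk>, y, z\<rbrakk> + \<lbrakk>x, \<lbrakk>u, v, y\<rbrakk>, z\<rbrakk> + \<lbrakk>x, y, \<lbrakk>u, v, z\<rbrakk>\<rbrakk>"
    and T3: "\<lbrakk>u, v, x \<star> y\<rbrakk> =
               \<lbrakk>u, v, x\<rbrakk> \<star> y + x \<star> \<lbrakk>u, v, y\<rbrakk> + \<lbrakk>x, y, u \<star> v\<rbrakk> - (x \<star> y) \<star> (u \<star> v)"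

definition symmetric_form :: "('a::real_vector \<Rightarrow> 'a \<Rightarrow> real) \<Rightarrow> bool" where
  "symmetric_form b \<longleftrightarrow> bilinear b \<and> (\<forall>x y. b x y = b y x)"

definition nondegenerate_form :: "('a::real_vector \<Rightarrow> 'a \<Rightarrow> real) \<Rightarrow> bool" where
  "nondegenerate_form b \<longleftrightarrow> (\<forall>x. (\<forall>y. b x y = 0) \<longrightarrow> x = 0)"

text \<open>The two alternatives for the ternary operation are equivalent for symmetric bilinear
  forms on a Bol algebra, see \<open>ternary_invariance_iff\<close> below.\<close>

definition invariant_form ::
  "('a::real_vector \<Rightarrow> 'a \<Rightarrow> 'a) \<Rightarrow> ('a \<Rightarrow> 'a \<Rightarrow> 'a \<Rightarrow> 'a) \<Rightarrow> ('a \<Rightarrow> 'a \<Rightarrow> real) \<Rightarrow> bool" where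
  "invariant_form mul br b \<longleftrightarrow>
     (\<forall>x y z. b (mul x y) z = b x (mul y z)) \<and>
     ((\<forall>x y z u. b (br x y z) u = b (br z u x) y) \<or>
      (\<forall>x y z u. b (br x y z) u = - b z (br x y u)))"

definition quadratic_structure ::
  "('a::real_vector \<Rightarrow> 'a \<Rightarrow> 'a) \<Rightarrow> ('a \<Rightarrow> 'a \<Rightarrow> 'a \<Rightarrow> 'a) \<Rightarrow> ('a \<Rightarrow> 'a \<Rightarrow> real) \<Rightarrow> bool" where
  "quadratic_structure mul br b \<longleftrightarrow>
     symmetric_form b \<and> nondegenerate_form b \<and> invariant_form mul br b"

lemma (in bol_algebra) ternary_invariance_iff:
  assumes "symmetric_form b"
  shows "(\<forall>x y z u. b \<lbrakk>x, y, z\<rbrakk> u = b \<lbrakk>z, u, x\<rbrakk> y) \<longleftrightarrow>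
         (\<forall>x y z u. b \<lbrakk>x, y, z\<rbrakk> u = - b z \<lbrakk>x, y, u\<rbrakk>)"
proof -
  have bil: "bilinear b" and sym: "b x y = b y x" for x y
    using assms by (auto simp: symmetric_form_def)
  have skew: "b \<lbrakk>x, y, z\<rbrakk> u = - b \<lbrakk>y, x, z\<rbrakk> u" for x y z u
    using T02[of x y z] bilinear_lneg[OF bil] by simp
  have cyc: "b \<lbrakk>x, y, z\<rbrakk> u + b \<lbrakk>y, z, x\<rbrakk> u + b \<lbrakk>z, x, y\<rbrakk> u = 0" for x y z u
    using T1[of x y z] bilinear_ladd[OF bil] bilinear_lzero[OF bil] by metis
  show ?thesis
  proof
    assume pair: "\<forall>x y z u. b \<lbrakk>x, y, z\<rbrakk> u = b \<lbrakk>z, u, x\<rbrakk> y"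
    show "\<forall>x y z u. b \<lbrakk>x, y, z\<rbrakk> u = - b z \<lbrakk>x, y, u\<rbrakk>"
      using pair skew sym by metis
  next
    assume "\<forall>x y z u. b \<lbrakk>x, y, z\<rbrakk> u = - b z \<lbrakk>x, y, u\<rbrakk>"
    then have skew': "b \<lbrakk>x, y, z\<rbrakk> u = - b \<lbrakk>x, y, u\<rbrakk> z" for x y z u
      using sym by metis
    show "\<forall>x y z u. b \<lbrakk>x, y, z\<rbrakk> u = b \<lbrakk>z, u, x\<rbrakk> y"
    proof (intro allI)
      fix x y z u
      show "b \<lbrakk>x, y, z\<rbrakk> u = b \<lbrakk>z, u, x\<rbrakk> y"
        using cyc[of x y z u] cyc[of y z u x] cyc[of z u x y] cyc[of u x y z]
          skew'[of x y z u] skew'[of y z x u] skew'[of z x y u]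
          skew'[of z u y x] skew'[of u y z x] skew'[of u x z y]
          skew[of u x y z] skew[of x z u y] skew[of x z y u] skew[of y u z x] skew[of y u x z]
          skew'[of y u z x] skew'[of x z u y] skew[of z x u y] skew[of u y z x]
          skew'[of u x y z] skew[of u x z y] skew'[of y z u x] skew'[of x u y z]
        by linarith
    qed
  qed
qed

end

theory Submission
  imports Defs
begin

text \<open>
  Skew symmetry of the product together with \<open>b (x \<star> y) z = b x (y \<star> z)\<close> makes the
  trilinear form \<open>b (x \<star> y) z\<close> alternating, so \<open>x \<star> y\<close> is orthogonal to the span of \<open>x\<close>
  and \<open>y\<close>. In dimension two the two members of a basis span everything, hence by
  nondegeneracy their product vanishes, and bilinearity makes the whole product zero.
\<close>

lemma (in bol_algebra) mul_self_eq_0: "x \<star> x = 0"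
proof -
  have "(2::real) *\<^sub>R (x \<star> x) = 0"
    unfolding scaleR_2 by (rule iffD1[OF eq_neg_iff_add_eq_0 T01])
  then show ?thesis by simp
qed

text \<open>It suffices to test \<open>z = x\<close> and \<open>z = y\<close>. Invariance gives
  \<open>b (x \<star> y) x = b x (y \<star> x)\<close>, which by symmetry of \<open>b\<close> and skew symmetry of the product
  is the negative of the left side, and \<open>b (x \<star> y) y = b x (y \<star> y) = 0\<close>.\<close>

lemma (in bol_algebra) product_orthogonal_span_factors:
  assumes sym: "symmetric_form b" and inv: "invariant_form mul br b"
    and z: "z \<in> span {x, y}"
  shows "b (x \<star> y) z = 0"
proof -
  have bil: "bilinear b" and comm: "b u v = b v u" for u v
    using sym by (auto simp: symmetric_form_def)
  have shift: "b (u \<star> v) w = b u (v \<star> w)" for u v w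
    using inv by (auto simp: invariant_form_def)
  have "b (x \<star> y) x = - b (x \<star> y) x"
  proof -
    have "b (x \<star> y) x = b x (- (x \<star> y))"
      using shift[of x y x] by (simp only: T01[of y x])
    also have "\<dots> = - b (x \<star> y) x"
      by (simp only: bilinear_rneg[OF bil] comm[of x])
    finally show ?thesis .
  qed
  then have "b (x \<star> y) x = 0" by simp
  moreover have "b (x \<star> y) y = 0"
    using shift[of x y y] bilinear_rzero[OF bil] by (simp add: mul_self_eq_0)
  moreover have "linear (b (x \<star> y))"
    using bil by (simp add: bilinear_def)
  ultimately show ?thesis
    using linear_eq_0_on_span[of "b (x \<star> y)" "{x, y}" z] z by auto
qed

theorem theorem2p4:
  fixes mul :: "'a::real_vector \<Rightarrow> 'a \<Rightarrow> 'a"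
    and br :: "'a \<Rightarrow> 'a \<Rightarrow> 'a \<Rightarrow> 'a"
  assumes "bol_algebra mul br"
    and "dim (UNIV :: 'a set) = 2"
    and "\<exists>x y. mul x y \<noteq> 0"
  shows "\<not> (\<exists>b :: 'a \<Rightarrow> 'a \<Rightarrow> real. quadratic_structure mul br b)"
proof
  interpret bol_algebra mul br by fact
  assume "\<exists>b :: 'a \<Rightarrow> 'a \<Rightarrow> real. quadratic_structure mul br b"
  then obtain b :: "'a \<Rightarrow> 'a \<Rightarrow> real" where sym: "symmetric_form b"
    and nondeg: "nondegenerate_form b" and inv: "invariant_form mul br b"
    by (auto simp: quadratic_structure_def)
  obtain B :: "'a set" where "UNIV \<subseteq> span B" and "card B = 2"
    using basis_exists[of "UNIV :: 'a set"] assms(2) by metis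
  then obtain e f :: 'a where ef: "span {e, f} = UNIV"
    by (auto simp: card_2_iff)
  have "b (mul e f) z = 0" for z
    using product_orthogonal_span_factors[OF sym inv] ef by simp
  then have ef0: "mul e f = 0"
    using nondeg by (auto simp: nondegenerate_form_def)
  then have "mul f e = 0" by (subst T01) simp
  then have basis_zero: "mul u v = 0" if "u \<in> {e, f}" "v \<in> {e, f}" for u v
    using that ef0 mul_self_eq_0 by auto
  have zero: "bilinear (\<lambda>(u::'a) (v::'a). 0::'a)"
    by (simp add: bilinear_def linear_iff)
  have "mul x y = 0" for x y
    by (rule bilinear_eq[OF bilinear_mul zero, of UNIV "{e, f}" UNIV "{e, f}"])
      (simp_all only: ef subset_refl UNIV_I basis_zero)
  then show False using assms(3) by simp
qed

end
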